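(* Let a regular network with adjacency matrix $A$ be given and let $\mathcal{L}$ be the lattice of all its synchrony subspaces. Every join-irreducible element $S$ of $\mathcal{L}$ is the smallest synchrony subspace containing some special Jordan subspace to the network. Consequently, the cardinality of the set of join-irreducible elements of $\mathcal{L}$ does not exceed the cardinality of the set of special Jordan subspaces to the network.
   Context: A regular network is a finite directed graph on cells $1,\dots,n$ (loops and multiple arrows allowed) in which every cell receives the same number $v$ of arrows (the valency). Its adjacency matrix $A=[a_{ij}]$ has $a_{ij}$ equal to the number of arrows cell $i$ receives from cell $j$; every row sum is $v$. $A$ acts on $\mathbb{C}^n$. A polydiagonal is a subspace of $\mathbb{C}^n$ of the form $\{x : x_i=x_j \text{ for all } (i,j)\in R\}$ for some (possibly empty) set $R$ of index pairs. A synchrony subspace is a polydiagonal invariant under $A$. The synchrony subspaces, ordered by inclusion, form a complete lattice $\mathcal{L}$: the meet is intersection and the join of $S_1,S_2$ is the smallest synchrony subspace containing $S_1+S_2$. An element $S\in\mathcal{L}$ is join-irreducible if it cannot be written as the join of two elements of $\mathcal{L}$ both different from $S$. $F=\{x_1=\cdots=x_n\}$ is the fully synchrony subspace. $P(W)$ is the smallest polydiagonal containing a subspace $W$. For an eigenvalue $\lambda$ of $A$, the generalized eigenspace is $G_\lambda=\operatorname{Ker}(A-\lambda I)^p$ for $p$ large. A Jordan chain of length $k$ for $\lambda$ is a sequence of nonzero vectors $x_1,\dots,x_k$ with $(A-\lambda I)x_1=0$ and $(A-\lambda I)x_i=x_{i-1}$ for $2\le i\le k$; a Jordan subspace is the span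 of a Jordan chain. A Jordan subspace $W$ of a generalized eigenspace $G$ is a special Jordan subspace to the network if for every Jordan subspace $U$ of $G$ with $\dim U=\dim W$ and $P(U)\subseteq P(W)$, either $P(U)=P(W)$ or $U=F$. *)

theory Defs
  imports "HOL-Analysis.Analysis"
begin

text \<open>Cells are the elements of a finite type 'n (so n = CARD('n) >= 1).
  The adjacency matrix has natural-number entries: A $ i $ j = number of arrows
  cell i receives from cell j.  Vectors live in complex ^ 'n.\<close>

definition regular_network :: "nat^'n^'n \<Rightarrow> nat \<Rightarrow> bool" where
  "regular_network A v \<longleftrightarrow> (\<forall>i. (\<Sum>j\<in>UNIV. A $ i $ j) = v)"

definition cmat :: "nat^'n^'n \<Rightarrow> complex^'n^'n" where
  "cmat A = (\<chi> i j. of_nat (A $ i $ j))"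

definition polydiagonal :: "(complex^'n) set \<Rightarrow> bool" where
  "polydiagonal S \<longleftrightarrow> (\<exists>R :: ('n \<times> 'n) set. S = {x. \<forall>(i,j)\<in>R. x $ i = x $ j})"

definition synchrony :: "nat^'n^'n \<Rightarrow> (complex^'n) set \<Rightarrow> bool" where
  "synchrony A S \<longleftrightarrow> polydiagonal S \<and> (\<forall>x\<in>S. cmat A *v x \<in> S)"

text \<open>Smallest synchrony subspace containing a set W.\<close>
definition syn_closure :: "nat^'n^'n \<Rightarrow> (complex^'n) set \<Rightarrow> (complex^'n) set" where
  "syn_closure A W = \<Inter>{T. synchrony A T \<and> W \<subseteq> T}"

text \<open>Join in the lattice: smallest synchrony subspace containing S1 + S2.\<close>
definition syn_join :: "nat^'n^'n \<Rightarrow> (complex^'n) set \<Rightarrow> (complex^'n) set \<Rightarrow> (complex^'n) set" where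
  "syn_join A S1 S2 = syn_closure A {x + y | x y. x \<in> S1 \<and> y \<in> S2}"

definition join_irreducible :: "nat^'n^'n \<Rightarrow> (complex^'n) set \<Rightarrow> bool" where
  "join_irreducible A S \<longleftrightarrow> synchrony A S \<and>
     \<not> (\<exists>S1 S2. synchrony A S1 \<and> synchrony A S2 \<and> S1 \<noteq> S \<and> S2 \<noteq> S \<and> S = syn_join A S1 S2)"

definition full_sync :: "(complex^'n) set" where
  "full_sync = {x. \<forall>i j. x $ i = x $ j}"

text \<open>Smallest polydiagonal containing W.\<close>
definition Pdiag :: "(complex^'n) set \<Rightarrow> (complex^'n) set" where
  "Pdiag W = \<Inter>{Q. polydiagonal Q \<and> W \<subseteq> Q}"

text \<open>The map A - lambda I.\<close>
definition shiftop :: "nat^'n^'n \<Rightarrow> complex \<Rightarrow> complex^'n \<Rightarrow> complex^'n" where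
  "shiftop A l x = cmat A *v x - l *s x"

definition eigenvalue :: "nat^'n^'n \<Rightarrow> complex \<Rightarrow> bool" where
  "eigenvalue A l \<longleftrightarrow> (\<exists>x. x \<noteq> 0 \<and> cmat A *v x = l *s x)"

definition gen_eigenspace :: "nat^'n^'n \<Rightarrow> complex \<Rightarrow> (complex^'n) set" where
  "gen_eigenspace A l = {x. \<exists>p. (shiftop A l ^^ p) x = 0}"

text \<open>Jordan chain x_1,...,x_k (list index 0..k-1), k >= 1.\<close>
definition jordan_chain :: "nat^'n^'n \<Rightarrow> complex \<Rightarrow> (complex^'n) list \<Rightarrow> bool" where
  "jordan_chain A l xs \<longleftrightarrow> xs \<noteq> [] \<and> (\<forall>x\<in>set xs. x \<noteq> 0) \<and>
     shiftop A l (xs ! 0) = 0 \<and>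
     (\<forall>i. 0 < i \<and> i < length xs \<longrightarrow> shiftop A l (xs ! i) = xs ! (i - 1))"

text \<open>W is a Jordan subspace of the generalized eigenspace G_l (l an eigenvalue).\<close>
definition jordan_subspace :: "nat^'n^'n \<Rightarrow> complex \<Rightarrow> (complex^'n) set \<Rightarrow> bool" where
  "jordan_subspace A l W \<longleftrightarrow> eigenvalue A l \<and>
     (\<exists>xs. jordan_chain A l xs \<and> set xs \<subseteq> gen_eigenspace A l \<and> W = vec.span (set xs))"

definition special_jordan :: "nat^'n^'n \<Rightarrow> (complex^'n) set \<Rightarrow> bool" where
  "special_jordan A W \<longleftrightarrow> (\<exists>l. jordan_subspace A l W \<and>
     (\<forall>U. jordan_subspace A l U \<and> vec.dim U = vec.dim W \<and> Pdiag U \<subseteq> Pdiag W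
          \<longrightarrow> Pdiag U = Pdiag W \<or> U = full_sync))"

end

(*
  A join-irreducible synchrony subspace S is the synchrony closure of a single vector x.
  Splitting x along the coprime factors of an annihilating polynomial (Bezout) gives
  summands in S, one of which must already generate S; by induction on the degree, S is
  generated by a generalized eigenvector, hence by the Jordan subspace that it spans.

  Among the Jordan subspaces generating S pick one, W, whose polydiagonal P(W) has least
  dimension. Suppose a Jordan subspace U for the same eigenvalue and of the same dimension
  has P(U) strictly inside P(W), and its eigenvector is not fully synchronous, say in
  coordinates i and j. Subtracting a suitable u in U from the top vector of the chain of W
  gives z whose whole orbit satisfies x_i = x_j; join-irreducibility makes z generate S,
  and the cyclic subspace of z has a strictly smaller polydiagonal than W, a contradiction.
  So the eigenvector of U is fully synchronous; a maximum principle for the regular network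
  then forces the eigenvalue to be the valency with no longer chains, i.e. U = F.
*)

theory Submission
  imports Defs "HOL-Computational_Algebra.Polynomial_Factorial"
    "HOL-Computational_Algebra.Fundamental_Theorem_Algebra" "HOL-Computational_Algebra.Field_as_Ring"
begin

section \<open>Polynomials in a linear map\<close>

lemma linear_funpow:
  fixes f :: "'a::field^'n \<Rightarrow> 'a^'n"
  assumes "Vector_Spaces.linear (*s) (*s) f"
  shows "Vector_Spaces.linear (*s) (*s) (f ^^ n)"
proof (induction n)
  case 0
  show ?case
    using vec.linear_id by (simp add: id_def)
next
  case (Suc n)
  with assms show ?case
    unfolding funpow_Suc_right by (rule Vector_Spaces.linear_compose)
qed

definition poly_act :: "('a::field^'n \<Rightarrow> 'a^'n) \<Rightarrow> 'a poly \<Rightarrow> 'a^'n \<Rightarrow> 'a^'n" where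
  "poly_act f p x = (\<Sum>i\<le>degree p. coeff p i *s (f ^^ i) x)"

lemma poly_act_eq_sum:
  assumes "degree p \<le> n"
  shows "poly_act f p x = (\<Sum>i\<le>n. coeff p i *s (f ^^ i) x)"
  unfolding poly_act_def
  by (rule sum.mono_neutral_left) (use assms in \<open>auto simp: coeff_eq_0\<close>)

lemma poly_act_0 [simp]: "poly_act f 0 x = 0"
  by (simp add: poly_act_def)

lemma poly_act_const: "poly_act f [:c:] x = c *s x"
  by (simp add: poly_act_def)

lemma poly_act_1 [simp]: "poly_act f 1 x = x"
  using poly_act_const[of f 1 x] by (simp add: one_pCons)

lemma poly_act_add: "poly_act f (p + q) x = poly_act f p x + poly_act f q x"
proof -
  define n where "n = max (degree p) (degree q)"
  have "degree (p + q) \<le> n" "degree p \<le> n" "degree q \<le> n"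
    unfolding n_def using degree_add_le_max by auto
  then show ?thesis
    by (simp only: poly_act_eq_sum coeff_add vector_sadd_rdistrib sum.distrib)
qed

lemma poly_act_diff: "poly_act f (p - q) x = poly_act f p x - poly_act f q x"
  using poly_act_add[of f "p - q" q x] by (simp add: algebra_simps)

lemma poly_act_smult: "poly_act f (smult c p) x = c *s poly_act f p x"
proof -
  have "degree (smult c p) \<le> degree p"
    by (rule degree_smult_le)
  then show ?thesis
    unfolding poly_act_eq_sum[of "smult c p" "degree p"] poly_act_def
    by (simp add: vec.scale_sum_right)
qed

lemma poly_act_sum: "poly_act f (\<Sum>i\<in>I. p i) x = (\<Sum>i\<in>I. poly_act f (p i) x)"
  by (induction I rule: infinite_finite_induct) (simp_all add: poly_act_add)

lemma poly_act_monom: "poly_act f (monom c n) x = c *s (f ^^ n) x"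
proof -
  have "poly_act f (monom c n) x = (\<Sum>i\<le>n. if i = n then c *s (f ^^ i) x else 0)"
    unfolding poly_act_eq_sum[OF degree_monom_le] by (rule sum.cong) auto
  then show ?thesis
    by simp
qed

context
  fixes f :: "'a::field^'n \<Rightarrow> 'a^'n"
  assumes linear_f: "Vector_Spaces.linear (*s) (*s) f"
begin

lemma poly_act_zero_right [simp]: "poly_act f p 0 = 0"
proof -
  have "(f ^^ i) 0 = 0" for i
    using linear_funpow[OF linear_f, THEN Vector_Spaces.linear.axioms(3)] by (rule module_hom.zero)
  then show ?thesis
    by (simp add: poly_act_def)
qed

lemma poly_act_pCons: "poly_act f (pCons a p) x = a *s x + f (poly_act f p x)"
proof -
  have hom: "module_hom (*s) (*s) f"
    using linear_f by (rule Vector_Spaces.linear.axioms(3))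
  have "degree (pCons a p) \<le> Suc (degree p)"
    by (simp add: degree_pCons_le)
  then have "poly_act f (pCons a p) x = (\<Sum>i\<le>Suc (degree p). coeff (pCons a p) i *s (f ^^ i) x)"
    by (rule poly_act_eq_sum)
  also have "\<dots> = a *s x + (\<Sum>i\<le>degree p. coeff p i *s f ((f ^^ i) x))"
    by (subst sum.atMost_Suc_shift) simp
  also have "\<dots> = a *s x + f (poly_act f p x)"
    unfolding poly_act_def by (simp add: module_hom.sum[OF hom] module_hom.scale[OF hom])
  finally show ?thesis .
qed

lemma poly_act_mult: "poly_act f (p * q) x = poly_act f p (poly_act f q x)"
proof (induction p)
  case (pCons a p)
  have "poly_act f (pCons a p * q) x = poly_act f (smult a q + pCons 0 (p * q)) x"
    by simp
  also have "\<dots> = a *s poly_act f q x + f (poly_act f p (poly_act f q x))"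
    by (simp add: poly_act_add poly_act_smult poly_act_pCons pCons.IH)
  also have "\<dots> = poly_act f (pCons a p) (poly_act f q x)"
    by (simp add: poly_act_pCons)
  finally show ?case .
qed simp

end

lemma poly_act_annihilator:
  fixes f :: "'a::field^'n \<Rightarrow> 'a^'n"
  shows "\<exists>p. p \<noteq> 0 \<and> poly_act f p x = 0"
proof -
  define g where "g i = (f ^^ i) x" for i
  define N where "N = CARD('n)"
  show ?thesis
  proof (cases "inj_on g {..N}")
    case True
    have "vec.dim (g ` {..N}) \<le> N"
      using vec.dim_subset[of "g ` {..N}" UNIV] by (simp add: card_cart_basis N_def)
    moreover have "card (g ` {..N}) = Suc N"
      using card_image[OF True] by simp
    ultimately have "vec.dependent (g ` {..N})"
      by (intro vec.dependent_biggerset_general) simp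
    then obtain u where u: "\<exists>v\<in>g ` {..N}. u v \<noteq> 0" "(\<Sum>v\<in>g ` {..N}. u v *s v) = 0"
      using vec.dependent_finite[of "g ` {..N}"] by auto
    define p where "p = (\<Sum>i\<le>N. monom (u (g i)) i)"
    have "coeff p i = u (g i)" if "i \<le> N" for i
      using that by (simp add: p_def coeff_sum)
    then have "p \<noteq> 0"
      using u(1) by auto
    have "poly_act f p x = (\<Sum>i\<le>N. u (g i) *s g i)"
      by (simp add: p_def poly_act_sum poly_act_monom g_def)
    also have "\<dots> = 0"
      using u(2) by (simp add: sum.reindex[OF True])
    finally show ?thesis
      using \<open>p \<noteq> 0\<close> by blast
  next
    case False
    then obtain i j where "i < j" and "g i = g j"
      unfolding inj_on_def by (metis linorder_neqE_nat)
    define p :: "'a poly" where "p = monom 1 j - monom 1 i"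
    have "coeff p j = 1"
      using \<open>i < j\<close> by (simp add: p_def)
    then have "p \<noteq> 0"
      by auto
    moreover have "poly_act f p x = 0"
      using \<open>g i = g j\<close> by (simp add: p_def poly_act_diff poly_act_monom g_def)
    ultimately show ?thesis
      by blast
  qed
qed

lemma poly_act_coprime_decomposition:
  fixes f :: "'a::field_gcd^'n \<Rightarrow> 'a^'n"
  assumes lin: "Vector_Spaces.linear (*s) (*s) f" and "coprime p q" and px: "poly_act f (p * q) x = 0"
  obtains r s where "x = poly_act f r x + poly_act f s x"
    and "poly_act f p (poly_act f r x) = 0" and "poly_act f q (poly_act f s x) = 0"
proof -
  define a where "a = fst (bezout_coefficients p q)"
  define b where "b = snd (bezout_coefficients p q)"
  have "a * p + b * q = 1"
    using bezout_coefficients_fst_snd[of p q] \<open>coprime p q\<close>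
    unfolding a_def b_def by (simp add: coprime_iff_gcd_eq_1)
  then have "x = poly_act f (b * q) x + poly_act f (a * p) x"
    using poly_act_add[of f "a * p" "b * q" x] by (simp add: add.commute)
  moreover have "poly_act f p (poly_act f (b * q) x) = poly_act f b (poly_act f (p * q) x)"
    by (simp add: poly_act_mult[OF lin, symmetric] mult.left_commute)
  moreover have "poly_act f q (poly_act f (a * p) x) = poly_act f a (poly_act f (p * q) x)"
    by (simp add: poly_act_mult[OF lin, symmetric] mult.left_commute mult.commute)
  ultimately show ?thesis
    using that px poly_act_zero_right[OF lin] by metis
qed

lemma poly_split_root_power:
  fixes p :: "complex poly"
  assumes "p \<noteq> 0" and "degree p \<noteq> 0"
  obtains a e q where "p = [:- a, 1:] ^ e * q" and "coprime ([:- a, 1:] ^ e) q"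
    and "q \<noteq> 0" and "degree q < degree p"
proof -
  have "\<not> constant (poly p)"
    using assms(2) by (simp add: constant_degree)
  then obtain a where "poly p a = 0"
    using fundamental_theorem_of_algebra by blast
  define e where "e = order a p"
  obtain q where p: "p = [:- a, 1:] ^ e * q" and q: "\<not> [:- a, 1:] dvd q"
    using order_decomp[OF assms(1)] unfolding e_def by blast
  have "e \<noteq> 0"
    using \<open>poly p a = 0\<close> assms(1) order_root unfolding e_def by blast
  have "prime_elem [:- a, 1:]"
    by (rule prime_elem_linear_field_poly) simp
  then have "coprime [:- a, 1:] q"
    using q by (rule prime_elem_imp_coprime)
  then have "coprime ([:- a, 1:] ^ e) q"
    by simp
  moreover have "q \<noteq> 0"
    using p assms(1) by auto
  moreover have "degree q < degree p"
    using p \<open>q \<noteq> 0\<close> \<open>e \<noteq> 0\<close> by (simp add: degree_mult_eq degree_linear_power)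
  ultimately show ?thesis
    using p that by blast
qed

section \<open>The shifted adjacency map\<close>

lemma linear_shiftop: "Vector_Spaces.linear (*s) (*s) (shiftop A l)"
  unfolding shiftop_def by (intro vec.module_hom_sub vec.linear_axioms vec.linear_scale_self)

lemmas linear_shiftop_pow = linear_funpow[OF linear_shiftop]
lemmas shiftop_pow_module_hom = linear_shiftop_pow[THEN Vector_Spaces.linear.axioms(3)]
lemmas shiftop_pow_add = module_hom.add[OF shiftop_pow_module_hom]
lemmas shiftop_pow_diff = module_hom.diff[OF shiftop_pow_module_hom]
lemmas shiftop_pow_scale = module_hom.scale[OF shiftop_pow_module_hom]
lemmas shiftop_pow_sum = module_hom.sum[OF shiftop_pow_module_hom]
lemmas shiftop_pow_span_image = module_hom.span_image[OF shiftop_pow_module_hom]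
lemmas shiftop_pow_zero [simp] = module_hom.zero[OF shiftop_pow_module_hom]
lemmas shiftop_zero [simp] = module_hom.zero[OF linear_shiftop[THEN Vector_Spaces.linear.axioms(3)]]
lemmas shiftop_scale = module_hom.scale[OF linear_shiftop[THEN Vector_Spaces.linear.axioms(3)]]

lemma shiftop_pow_vanishes_beyond:
  assumes "(shiftop A l ^^ k) x = 0" and "k \<le> m"
  shows "(shiftop A l ^^ m) x = 0"
proof -
  have "(shiftop A l ^^ (m - k + k)) x = (shiftop A l ^^ (m - k)) ((shiftop A l ^^ k) x)"
    by (simp only: funpow_add comp_apply)
  then show ?thesis
    using assms by simp
qed

lemma poly_act_linear_power: "poly_act ((*v) (cmat A)) ([:- a, 1:] ^ e) x = (shiftop A a ^^ e) x"
proof (induction e)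
  case (Suc e)
  have linear: "poly_act ((*v) (cmat A)) [:- a, 1:] y = shiftop A a y" for y
    by (simp add: poly_act_pCons[OF vec.linear_axioms] shiftop_def)
  have "poly_act ((*v) (cmat A)) ([:- a, 1:] ^ Suc e) x
      = poly_act ((*v) (cmat A)) [:- a, 1:] (poly_act ((*v) (cmat A)) ([:- a, 1:] ^ e) x)"
    by (simp only: power_Suc poly_act_mult[OF vec.linear_axioms])
  then show ?case
    by (simp add: linear Suc.IH)
qed simp

section \<open>Polydiagonals\<close>

lemma polydiagonal_Inter:
  assumes "\<forall>Q\<in>F. polydiagonal Q"
  shows "polydiagonal (\<Inter>F)"
proof -
  from assms have "\<forall>Q\<in>F. \<exists>R. Q = {x. \<forall>(i, j)\<in>R. x $ i = x $ j}"
    by (simp add: polydiagonal_def)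
  then obtain R where R: "\<forall>Q\<in>F. Q = {x. \<forall>(i, j)\<in>R Q. x $ i = x $ j}"
    by (rule bchoice[THEN exE])
  have mem: "x \<in> Q \<longleftrightarrow> (\<forall>(i, j)\<in>R Q. x $ i = x $ j)" if "Q \<in> F" for Q x
  proof -
    have "Q = {x. \<forall>(i, j)\<in>R Q. x $ i = x $ j}"
      using R that by (rule bspec)
    then show ?thesis
      unfolding set_eq_iff by simp
  qed
  have "x \<in> \<Inter>F \<longleftrightarrow> (\<forall>(i, j)\<in>(\<Union>Q\<in>F. R Q). x $ i = x $ j)" for x
  proof -
    have "x \<in> \<Inter>F \<longleftrightarrow> (\<forall>Q\<in>F. \<forall>(i, j)\<in>R Q. x $ i = x $ j)"
      unfolding Inter_iff by (rule ball_cong[OF refl mem])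
    then show ?thesis
      by blast
  qed
  then have "\<Inter>F = {x. \<forall>(i, j)\<in>(\<Union>Q\<in>F. R Q). x $ i = x $ j}"
    by blast
  then show ?thesis
    unfolding polydiagonal_def by (rule exI[of _ "\<Union>Q\<in>F. R Q"])
qed

lemma polydiagonal_Int: "polydiagonal P \<Longrightarrow> polydiagonal Q \<Longrightarrow> polydiagonal (P \<inter> Q)"
  using polydiagonal_Inter[of "{P, Q}"] by simp

lemma polydiagonal_coordinates_eq: "polydiagonal {x. x $ i = x $ j}"
  unfolding polydiagonal_def by (rule exI[of _ "{(i, j)}"]) simp

lemma polydiagonal_subspace: "polydiagonal Q \<Longrightarrow> vec.subspace Q"
  unfolding polydiagonal_def vec.subspace_def by (fastforce simp: case_prod_beta)

lemma full_sync_subset_polydiagonal: "polydiagonal Q \<Longrightarrow> full_sync \<subseteq> Q"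
  unfolding polydiagonal_def full_sync_def by auto

lemma Pdiag_hull: "Pdiag W = polydiagonal hull W"
  unfolding Pdiag_def hull_def ..

lemma polydiagonal_Pdiag: "polydiagonal (Pdiag W)"
  unfolding Pdiag_hull by (rule hull_in) (simp add: polydiagonal_Inter)

lemma subspace_Pdiag: "vec.subspace (Pdiag W)"
  by (rule polydiagonal_subspace[OF polydiagonal_Pdiag])

lemma subset_Pdiag: "W \<subseteq> Pdiag W"
  unfolding Pdiag_hull by (rule hull_subset)

lemma Pdiag_least: "polydiagonal Q \<Longrightarrow> W \<subseteq> Q \<Longrightarrow> Pdiag W \<subseteq> Q"
  unfolding Pdiag_hull by (rule hull_minimal)

lemma dim_Pdiag_psubset: "Pdiag X \<subset> Pdiag Y \<Longrightarrow> vec.dim (Pdiag X) < vec.dim (Pdiag Y)"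
  by (metis subspace_Pdiag vec.dim_psubset vec.span_eq_iff)

section \<open>The lattice of synchrony subspaces\<close>

lemma synchrony_Inter: "\<forall>T\<in>F. synchrony A T \<Longrightarrow> synchrony A (\<Inter>F)"
  unfolding synchrony_def using polydiagonal_Inter by blast

lemma synchrony_subspace: "synchrony A T \<Longrightarrow> vec.subspace T"
  unfolding synchrony_def using polydiagonal_subspace by blast

lemma synchrony_cmat: "synchrony A T \<Longrightarrow> x \<in> T \<Longrightarrow> cmat A *v x \<in> T"
  unfolding synchrony_def by blast

lemma synchrony_shiftop_pow:
  assumes T: "synchrony A T" and x: "x \<in> T"
  shows "(shiftop A l ^^ m) x \<in> T"
proof (induction m)
  case (Suc m)
  have "vec.subspace T"
    using T by (rule synchrony_subspace)
  then have "shiftop A l ((shiftop A l ^^ m) x) \<in> T"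
    unfolding shiftop_def[of A l "(shiftop A l ^^ m) x"]
    by (intro vec.subspace_diff vec.subspace_scale synchrony_cmat[OF T] Suc.IH)
  then show ?case
    by simp
qed (simp add: x)

lemma syn_closure_hull: "syn_closure A W = synchrony A hull W"
  unfolding syn_closure_def hull_def ..

lemma synchrony_syn_closure: "synchrony A (syn_closure A W)"
  unfolding syn_closure_hull by (rule hull_in) (simp add: synchrony_Inter)

lemma subspace_syn_closure: "vec.subspace (syn_closure A W)"
  by (rule synchrony_subspace[OF synchrony_syn_closure])

lemma subset_syn_closure: "W \<subseteq> syn_closure A W"
  unfolding syn_closure_hull by (rule hull_subset)

lemma syn_closure_least: "synchrony A T \<Longrightarrow> W \<subseteq> T \<Longrightarrow> syn_closure A W \<subseteq> T"
  unfolding syn_closure_hull by (rule hull_minimal)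

lemma syn_closure_mono: "V \<subseteq> W \<Longrightarrow> syn_closure A V \<subseteq> syn_closure A W"
  unfolding syn_closure_hull by (rule hull_mono)

lemma syn_closure_span: "syn_closure A (vec.span W) = syn_closure A W"
  by (meson subset_antisym subset_syn_closure subspace_syn_closure syn_closure_least
      syn_closure_mono synchrony_syn_closure vec.span_minimal vec.span_superset)

lemma syn_closure_empty: "syn_closure A {} = syn_closure A {0}"
  using syn_closure_least[OF synchrony_syn_closure, of "{0}" A "{}"]
    vec.subspace_0[OF subspace_syn_closure] syn_closure_mono[of "{}" "{0}"] by blast

lemma full_sync_eq: "full_sync = range (\<lambda>c. c *s 1)"
proof -
  have "x = (x $ i) *s 1" if "x \<in> full_sync" for x :: "complex^'n" and i
    using that by (simp add: full_sync_def vec_eq_iff)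
  then show ?thesis
    unfolding full_sync_def by auto
qed

lemma cmat_mult_one:
  assumes "regular_network A v"
  shows "cmat A *v 1 = of_nat v *s 1"
proof -
  have "(\<Sum>j\<in>UNIV. of_nat (A $ i $ j)) = (of_nat v :: complex)" for i
    using assms unfolding regular_network_def by (metis of_nat_sum)
  then show ?thesis
    by (simp add: cmat_def matrix_vector_mult_def vec_eq_iff)
qed

lemma span_scaled_one:
  assumes "c \<noteq> 0"
  shows "vec.span {c *s (1 :: complex^'n)} = full_sync"
  unfolding full_sync_eq vec.span_singleton
proof (intro equalityI subsetI)
  fix x :: "complex^'n" assume "x \<in> range (\<lambda>k. k *s (c *s 1))"
  then obtain k where "x = (k * c) *s 1"
    by auto
  then show "x \<in> range (\<lambda>d. d *s 1)"
    by blast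
next
  fix x :: "complex^'n" assume "x \<in> range (\<lambda>d. d *s 1)"
  then obtain d where "x = (d / c) *s (c *s 1)"
    using assms by auto
  then show "x \<in> range (\<lambda>k. k *s (c *s 1))"
    by blast
qed

lemma synchrony_full_sync:
  fixes A :: "nat^'n^'n"
  assumes "regular_network A v"
  shows "synchrony A full_sync"
  unfolding synchrony_def
proof (intro conjI ballI)
  show "polydiagonal (full_sync :: (complex^'n) set)"
    unfolding polydiagonal_def full_sync_def by (rule exI[of _ UNIV]) auto
  fix x :: "complex^'n" assume "x \<in> full_sync"
  then obtain c where "x = c *s 1"
    by (auto simp: full_sync_eq)
  then have "cmat A *v x = (c * of_nat v) *s 1"
    by (simp add: vec.scale cmat_mult_one[OF assms])
  then show "cmat A *v x \<in> full_sync"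
    unfolding full_sync_eq by blast
qed

lemma full_sync_subset_synchrony: "synchrony A T \<Longrightarrow> full_sync \<subseteq> T"
  unfolding synchrony_def using full_sync_subset_polydiagonal by blast

lemma syn_closure_full_sync:
  assumes "regular_network A v" and "x \<in> full_sync"
  shows "syn_closure A {x} = full_sync"
proof (rule antisym)
  show "syn_closure A {x} \<subseteq> full_sync"
    using assms(2) by (intro syn_closure_least[OF synchrony_full_sync[OF assms(1)]]) simp
  show "full_sync \<subseteq> syn_closure A {x}"
    by (rule full_sync_subset_synchrony[OF synchrony_syn_closure])
qed

lemma synchrony_poly_act:
  assumes T: "synchrony A T" and x: "x \<in> T"
  shows "poly_act ((*v) (cmat A)) p x \<in> T"
proof -
  have sub: "vec.subspace T"
    using T by (rule synchrony_subspace)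
  have "((*v) (cmat A) ^^ i) x \<in> T" for i
    by (induction i) (simp_all add: x synchrony_cmat[OF T])
  then show ?thesis
    unfolding poly_act_def by (intro vec.subspace_sum[OF sub] vec.subspace_scale[OF sub])
qed

section \<open>Join-irreducible synchrony subspaces\<close>

lemma syn_join_mem:
  assumes "x \<in> S1" and "y \<in> S2"
  shows "x + y \<in> syn_join A S1 S2"
proof -
  have "x + y \<in> {a + b |a b. a \<in> S1 \<and> b \<in> S2}"
    using assms by blast
  then show ?thesis
    unfolding syn_join_def by (rule subsetD[OF subset_syn_closure])
qed

lemma synchrony_syn_join: "synchrony A (syn_join A S1 S2)"
  unfolding syn_join_def by (rule synchrony_syn_closure)

lemma syn_closure_Un: "syn_closure A (X \<union> Y) = syn_join A (syn_closure A X) (syn_closure A Y)"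
proof
  have "x \<in> syn_join A (syn_closure A X) (syn_closure A Y)" if "x \<in> X" for x
  proof -
    have "x + 0 \<in> syn_join A (syn_closure A X) (syn_closure A Y)"
      using that subset_syn_closure vec.subspace_0[OF subspace_syn_closure]
      by (intro syn_join_mem) auto
    then show ?thesis
      by simp
  qed
  moreover have "y \<in> syn_join A (syn_closure A X) (syn_closure A Y)" if "y \<in> Y" for y
  proof -
    have "0 + y \<in> syn_join A (syn_closure A X) (syn_closure A Y)"
      using that subset_syn_closure vec.subspace_0[OF subspace_syn_closure]
      by (intro syn_join_mem) auto
    then show ?thesis
      by simp
  qed
  ultimately show "syn_closure A (X \<union> Y) \<subseteq> syn_join A (syn_closure A X) (syn_closure A Y)"
    by (intro syn_closure_least[OF synchrony_syn_join]) auto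
  have "a + b \<in> syn_closure A (X \<union> Y)" if "a \<in> syn_closure A X" and "b \<in> syn_closure A Y" for a b
    using that syn_closure_mono[of X "X \<union> Y" A] syn_closure_mono[of Y "X \<union> Y" A]
    by (intro vec.subspace_add[OF subspace_syn_closure]) auto
  then show "syn_join A (syn_closure A X) (syn_closure A Y) \<subseteq> syn_closure A (X \<union> Y)"
    unfolding syn_join_def by (intro syn_closure_least[OF synchrony_syn_closure]) auto
qed

lemma join_irreducible_synchrony: "join_irreducible A S \<Longrightarrow> synchrony A S"
  unfolding join_irreducible_def by (rule conjunct1)

lemma join_irreducible_syn_closure_Un:
  assumes "join_irreducible A S" and "syn_closure A (X \<union> Y) = S"
  shows "syn_closure A X = S \<or> syn_closure A Y = S"
proof -
  have "S = syn_join A (syn_closure A X) (syn_closure A Y)"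
    using assms(2) by (simp add: syn_closure_Un)
  with assms(1) show ?thesis
    unfolding join_irreducible_def using synchrony_syn_closure by metis
qed

lemma syn_closure_eq_generated:
  assumes "synchrony A S" and "X \<subseteq> S" and "x \<in> vec.span X" and "syn_closure A {x} = S"
  shows "syn_closure A X = S"
proof
  show "syn_closure A X \<subseteq> S"
    using assms(1,2) by (rule syn_closure_least)
  have "x \<in> syn_closure A X"
    using assms(3) vec.span_minimal[OF subset_syn_closure subspace_syn_closure] by blast
  then show "S \<subseteq> syn_closure A X"
    unfolding assms(4)[symmetric] by (intro syn_closure_least[OF synchrony_syn_closure]) simp
qed

lemma join_irreducible_syn_closure_add:
  assumes ji: "join_irreducible A S" and S: "syn_closure A {y + z} = S"
    and "y \<in> S" and "z \<in> Z" and "Z \<subseteq> S"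
  shows "syn_closure A {y} = S \<or> syn_closure A Z = S"
proof -
  have "y + z \<in> vec.span ({y} \<union> Z)"
    using assms(4) by (intro vec.span_add vec.span_base) auto
  moreover have "{y} \<union> Z \<subseteq> S"
    using assms(3,5) by blast
  ultimately have "syn_closure A ({y} \<union> Z) = S"
    using syn_closure_eq_generated[OF join_irreducible_synchrony[OF ji] _ _ S] by blast
  then show ?thesis
    by (rule join_irreducible_syn_closure_Un[OF ji])
qed

lemma join_irreducible_single_generator:
  assumes ji: "join_irreducible A S"
  shows "\<exists>x. syn_closure A {x} = S"
proof -
  have S: "synchrony A S"
    using ji by (rule join_irreducible_synchrony)
  obtain B where B: "B \<subseteq> S" "vec.independent B" "S \<subseteq> vec.span B"
    by (meson vec.basis_exists)
  have "S \<subseteq> syn_closure A B"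
    using B(3) vec.span_minimal[OF subset_syn_closure subspace_syn_closure] by blast
  with syn_closure_least[OF S B(1)] have "syn_closure A B = S"
    by (rule antisym)
  with vec.finiteI_independent[OF B(2)] show ?thesis
  proof (induction B rule: finite_induct)
    case empty
    then show ?case using syn_closure_empty by blast
  next
    case (insert b B)
    then show ?case
      using join_irreducible_syn_closure_Un[OF ji, of "{b}" B] by auto
  qed
qed

section \<open>Jordan chains and cyclic subspaces\<close>

definition cyclic_subspace :: "nat^'n^'n \<Rightarrow> complex \<Rightarrow> complex^'n \<Rightarrow> (complex^'n) set" where
  "cyclic_subspace A l y = vec.span (range (\<lambda>m. (shiftop A l ^^ m) y))"

lemma shiftop_pow_cyclic_subspace:
  assumes "u \<in> cyclic_subspace A l y"
  shows "(shiftop A l ^^ m) u \<in> cyclic_subspace A l y"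
proof -
  have "(shiftop A l ^^ m) ((shiftop A l ^^ j) y) = (shiftop A l ^^ (m + j)) y" for j
    by (simp add: funpow_add)
  then have "(shiftop A l ^^ m) ` range (\<lambda>j. (shiftop A l ^^ j) y) \<subseteq> range (\<lambda>j. (shiftop A l ^^ j) y)"
    by auto
  then have "(shiftop A l ^^ m) ` cyclic_subspace A l y \<subseteq> cyclic_subspace A l y"
    unfolding cyclic_subspace_def shiftop_pow_span_image[symmetric] by (rule vec.span_mono)
  with assms show ?thesis
    by blast
qed

lemma cyclic_subspace_annihilated:
  assumes "(shiftop A l ^^ k) y = 0" and "u \<in> cyclic_subspace A l y"
  shows "(shiftop A l ^^ k) u = 0"
proof -
  have "(shiftop A l ^^ k) ((shiftop A l ^^ j) y) = (shiftop A l ^^ j) ((shiftop A l ^^ k) y)" for j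
    by (metis add.commute comp_apply funpow_add)
  then have "(shiftop A l ^^ k) ` range (\<lambda>j. (shiftop A l ^^ j) y) \<subseteq> {0}"
    using assms(1) by auto
  then have "(shiftop A l ^^ k) ` cyclic_subspace A l y \<subseteq> vec.span {0}"
    unfolding cyclic_subspace_def shiftop_pow_span_image[symmetric] by (rule vec.span_mono)
  also have "vec.span {0} = {0}"
    using vec.span_insert_0[of "{}"] by simp
  finally have "(shiftop A l ^^ k) ` cyclic_subspace A l y \<subseteq> {0}" .
  then show ?thesis
    using imageI[OF assms(2)] by (rule subsetD[THEN singletonD])
qed

lemma cyclic_subspace_self: "y \<in> cyclic_subspace A l y"
  unfolding cyclic_subspace_def by (rule vec.span_base) (simp add: range_eqI[of _ _ 0])

lemma cyclic_subspace_subset: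
  assumes "u \<in> cyclic_subspace A l y"
  shows "cyclic_subspace A l u \<subseteq> cyclic_subspace A l y"
proof -
  have "range (\<lambda>m. (shiftop A l ^^ m) u) \<subseteq> cyclic_subspace A l y"
    using shiftop_pow_cyclic_subspace[OF assms] by blast
  then show ?thesis
    unfolding cyclic_subspace_def[of A l u] by (rule vec.span_minimal) (simp add: cyclic_subspace_def)
qed

lemma Pdiag_cyclic_subspace_least:
  assumes Q: "polydiagonal Q" and orbit: "\<And>m. (shiftop A l ^^ m) y \<in> Q"
  shows "Pdiag (cyclic_subspace A l y) \<subseteq> Q"
proof -
  have "cyclic_subspace A l y \<subseteq> Q"
    unfolding cyclic_subspace_def using orbit polydiagonal_subspace[OF Q]
    by (intro vec.span_minimal) auto
  with Q show ?thesis
    by (rule Pdiag_least)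
qed

lemma syn_closure_cyclic_subspace: "syn_closure A (cyclic_subspace A l y) = syn_closure A {y}"
  unfolding cyclic_subspace_def syn_closure_span
proof (rule antisym)
  have "y \<in> syn_closure A {y}"
    by (rule subsetD[OF subset_syn_closure]) simp
  then have "range (\<lambda>m. (shiftop A l ^^ m) y) \<subseteq> syn_closure A {y}"
    by (auto intro: synchrony_shiftop_pow[OF synchrony_syn_closure])
  then show "syn_closure A (range (\<lambda>m. (shiftop A l ^^ m) y)) \<subseteq> syn_closure A {y}"
    by (rule syn_closure_least[OF synchrony_syn_closure])
  have "{y} \<subseteq> range (\<lambda>m. (shiftop A l ^^ m) y)"
    using range_eqI[of y "\<lambda>m. (shiftop A l ^^ m) y" 0] by simp
  then show "syn_closure A {y} \<subseteq> syn_closure A (range (\<lambda>m. (shiftop A l ^^ m) y))"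
    by (rule syn_closure_mono)
qed

lemma jordan_chain_shiftop_pow_nth:
  assumes "jordan_chain A l xs" and "i < length xs"
  shows "(shiftop A l ^^ j) (xs ! i) = (if j \<le> i then xs ! (i - j) else 0)"
proof (induction j)
  case (Suc j)
  with assms show ?case
    unfolding jordan_chain_def by (cases "j < i") (auto simp: Suc_diff_Suc)
qed simp

lemma jordan_chain_last_annihilated:
  assumes "jordan_chain A l xs"
  shows "(shiftop A l ^^ length xs) (last xs) = 0"
proof -
  obtain k where k: "length xs = Suc k"
    using assms unfolding jordan_chain_def by (cases xs) auto
  then have "last xs = xs ! k"
    by (metis last_conv_nth diff_Suc_1 list.size(3) nat.distinct(1))
  then show ?thesis
    using jordan_chain_shiftop_pow_nth[OF assms, of k "Suc k"] k by simp
qed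

lemma jordan_chain_span:
  assumes xs: "jordan_chain A l xs"
  shows "vec.span (set xs) = cyclic_subspace A l (last xs)"
proof -
  define k where "k = length xs"
  have k: "0 < k" "last xs = xs ! (k - 1)"
    using xs unfolding jordan_chain_def k_def by (auto simp: last_conv_nth)
  have pow: "(shiftop A l ^^ m) (last xs) = (if m < k then xs ! (k - 1 - m) else 0)" for m
  proof -
    have "m \<le> k - 1 \<longleftrightarrow> m < k"
      using k(1) by arith
    then show ?thesis
      using jordan_chain_shiftop_pow_nth[OF xs, of "k - 1" m] k unfolding k_def by simp
  qed
  have "range (\<lambda>m. (shiftop A l ^^ m) (last xs)) = insert 0 (set xs)"
  proof (intro equalityI subsetI)
    fix v assume "v \<in> range (\<lambda>m. (shiftop A l ^^ m) (last xs))"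
    then show "v \<in> insert 0 (set xs)"
      using pow k_def by auto
  next
    fix v assume v: "v \<in> insert 0 (set xs)"
    have "0 = (shiftop A l ^^ k) (last xs)"
      using pow by simp
    moreover have "xs ! i = (shiftop A l ^^ (k - 1 - i)) (last xs)" if "i < k" for i
      using pow that by simp
    ultimately show "v \<in> range (\<lambda>m. (shiftop A l ^^ m) (last xs))"
      using v k_def by (auto simp: in_set_conv_nth)
  qed
  then show ?thesis
    unfolding cyclic_subspace_def by simp
qed

lemma jordan_chain_distinct:
  assumes xs: "jordan_chain A l xs"
  shows "distinct xs"
proof -
  have "xs ! a \<noteq> xs ! b" if "a < b" and "b < length xs" for a b
  proof
    assume "xs ! a = xs ! b"
    then have "(shiftop A l ^^ b) (xs ! a) = (shiftop A l ^^ b) (xs ! b)"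
      by simp
    then have "xs ! 0 = 0"
      using jordan_chain_shiftop_pow_nth[OF xs, of a b] jordan_chain_shiftop_pow_nth[OF xs, of b b] that
      by simp
    then show False
      using xs that unfolding jordan_chain_def by auto
  qed
  then show ?thesis
    unfolding distinct_conv_nth by (metis linorder_neqE_nat)
qed

lemma jordan_chain_independent:
  assumes xs: "jordan_chain A l xs"
  shows "vec.independent (set xs)"
proof
  assume "vec.dependent (set xs)"
  then obtain u where u: "\<exists>v\<in>set xs. u v \<noteq> 0" "(\<Sum>v\<in>set xs. u v *s v) = 0"
    using vec.dependent_finite by blast
  have "distinct xs"
    using xs by (rule jordan_chain_distinct)
  then have sum0: "(\<Sum>i<length xs. u (xs ! i) *s xs ! i) = 0"
    using u(2) by (simp add: sum.distinct_set_conv_list sum_list_sum_nth atLeast0LessThan)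
  define I where "I = {i. i < length xs \<and> u (xs ! i) \<noteq> 0}"
  have "finite I" "I \<noteq> {}"
    using u(1) unfolding I_def by (auto simp: in_set_conv_nth)
  define m where "m = Max I"
  have m: "m < length xs" "u (xs ! m) \<noteq> 0" and above: "\<And>i. i \<in> I \<Longrightarrow> i \<le> m"
    using Max_in[OF \<open>finite I\<close> \<open>I \<noteq> {}\<close>] \<open>finite I\<close> unfolding m_def I_def by auto
  \<comment> \<open>Applying the \<open>m\<close>-th power kills every term except the one of largest index.\<close>
  have killed: "u (xs ! i) *s (shiftop A l ^^ m) (xs ! i) = (if i = m then u (xs ! m) *s xs ! 0 else 0)"
    if "i < length xs" for i
    using jordan_chain_shiftop_pow_nth[OF xs that, of m] above[of i] that unfolding I_def
    by (cases "i < m") auto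
  have "0 = (shiftop A l ^^ m) (\<Sum>i<length xs. u (xs ! i) *s xs ! i)"
    using sum0 by simp
  also have "\<dots> = (\<Sum>i<length xs. u (xs ! i) *s (shiftop A l ^^ m) (xs ! i))"
    by (simp add: shiftop_pow_sum shiftop_pow_scale)
  also have "\<dots> = (\<Sum>i<length xs. if i = m then u (xs ! m) *s xs ! 0 else 0)"
    by (rule sum.cong) (simp_all add: killed)
  also have "\<dots> = u (xs ! m) *s xs ! 0"
    using m(1) by simp
  finally have "u (xs ! m) *s xs ! 0 = 0"
    by simp
  then show False
    using m xs unfolding jordan_chain_def by auto
qed

lemma jordan_chain_dim: "jordan_chain A l xs \<Longrightarrow> vec.dim (vec.span (set xs)) = length xs"
  by (simp add: vec.dim_eq_card_independent jordan_chain_independent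
      distinct_card jordan_chain_distinct)

lemma jordan_chain_gen_eigenspace:
  assumes xs: "jordan_chain A l xs"
  shows "set xs \<subseteq> gen_eigenspace A l"
proof
  fix x assume "x \<in> set xs"
  then obtain i where "i < length xs" "x = xs ! i"
    by (auto simp: in_set_conv_nth)
  then have "(shiftop A l ^^ Suc i) x = 0"
    using jordan_chain_shiftop_pow_nth[OF xs, of i "Suc i"] by simp
  then show "x \<in> gen_eigenspace A l"
    unfolding gen_eigenspace_def by blast
qed

lemma jordan_chain_eigenvalue:
  assumes "jordan_chain A l xs"
  shows "eigenvalue A l"
proof -
  have "xs ! 0 \<noteq> 0" and "shiftop A l (xs ! 0) = 0"
    using assms unfolding jordan_chain_def by auto
  then show ?thesis
    unfolding eigenvalue_def shiftop_def by (metis eq_iff_diff_eq_0)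
qed

lemma jordan_subspace_span_chain: "jordan_chain A l xs \<Longrightarrow> jordan_subspace A l (vec.span (set xs))"
  unfolding jordan_subspace_def using jordan_chain_eigenvalue jordan_chain_gen_eigenspace by blast

lemma jordan_chain_ending_at:
  assumes "y \<noteq> 0" and "(shiftop A l ^^ k) y = 0"
  obtains xs where "jordan_chain A l xs" and "last xs = y"
proof -
  define h where "h = (LEAST h. (shiftop A l ^^ h) y = 0)"
  have h: "(shiftop A l ^^ h) y = 0"
    unfolding h_def using assms(2) by (rule LeastI)
  have below: "(shiftop A l ^^ m) y \<noteq> 0" if "m < h" for m
    using that not_less_Least unfolding h_def by blast
  have "h \<noteq> 0"
    using h assms(1) by (cases h) auto
  define xs where "xs = map (\<lambda>i. (shiftop A l ^^ (h - 1 - i)) y) [0..<h]"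
  have len: "length xs = h"
    unfolding xs_def by simp
  have nth: "xs ! i = (shiftop A l ^^ (h - 1 - i)) y" if "i < h" for i
    using that unfolding xs_def by simp
  have "jordan_chain A l xs"
    unfolding jordan_chain_def
  proof (intro conjI allI impI ballI)
    show "xs \<noteq> []"
      using \<open>h \<noteq> 0\<close> unfolding xs_def by simp
    show "x \<noteq> 0" if "x \<in> set xs" for x
      using that below unfolding xs_def by auto
    show "shiftop A l (xs ! 0) = 0"
      using \<open>h \<noteq> 0\<close> h nth[of 0] by (cases h) simp_all
    fix i assume i: "0 < i \<and> i < length xs"
    then have "Suc (h - 1 - i) = h - 1 - (i - 1)"
      using len by arith
    then show "shiftop A l (xs ! i) = xs ! (i - 1)"
      using i len nth[of i] nth[of "i - 1"] by (metis comp_apply funpow.simps(2) less_imp_diff_less)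
  qed
  moreover have "last xs = y"
    using \<open>h \<noteq> 0\<close> unfolding xs_def by (simp add: last_map)
  ultimately show ?thesis
    by (rule that)
qed

lemma jordan_subspace_cyclic_subspace:
  assumes "y \<noteq> 0" and "(shiftop A l ^^ k) y = 0"
  shows "jordan_subspace A l (cyclic_subspace A l y)"
proof -
  obtain xs where "jordan_chain A l xs" and "last xs = y"
    using jordan_chain_ending_at[OF assms] .
  then show ?thesis
    using jordan_subspace_span_chain jordan_chain_span by metis
qed

section \<open>Jordan subspaces generating join-irreducible synchrony subspaces\<close>

lemma join_irreducible_generalized_eigenvector_generator:
  assumes ji: "join_irreducible A S"
  shows "syn_closure A {x} = S \<Longrightarrow> p \<noteq> 0 \<Longrightarrow> poly_act ((*v) (cmat A)) p x = 0 \<Longrightarrow>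
    \<exists>y a e. (shiftop A a ^^ e) y = 0 \<and> syn_closure A {y} = S"
proof (induction "degree p" arbitrary: p x rule: less_induct)
  case less
  show ?case
  proof (cases "degree p = 0")
    case True
    then obtain c where "p = [:c:]"
      by (rule degree_eq_zeroE)
    with less.prems have "(shiftop A 0 ^^ 0) x = 0"
      by (simp add: poly_act_const)
    with less.prems(1) show ?thesis
      by blast
  next
    case False
    then obtain a e q where p: "p = [:- a, 1:] ^ e * q" and "coprime ([:- a, 1:] ^ e) q"
      and "q \<noteq> 0" and "degree q < degree p"
      using poly_split_root_power[OF less.prems(2)] by blast
    then obtain r s where x: "x = poly_act ((*v) (cmat A)) r x + poly_act ((*v) (cmat A)) s x"
      and r: "poly_act ((*v) (cmat A)) ([:- a, 1:] ^ e) (poly_act ((*v) (cmat A)) r x) = 0"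
      and s: "poly_act ((*v) (cmat A)) q (poly_act ((*v) (cmat A)) s x) = 0"
      using poly_act_coprime_decomposition[OF vec.linear_axioms _ less.prems(3)[unfolded p]] by blast
    define y where "y = poly_act ((*v) (cmat A)) r x"
    define z where "z = poly_act ((*v) (cmat A)) s x"
    have "x \<in> S"
      using less.prems(1) subset_syn_closure by blast
    then have "y \<in> S" and "z \<in> S"
      unfolding y_def z_def by (simp_all add: synchrony_poly_act[OF join_irreducible_synchrony[OF ji]])
    moreover have "syn_closure A {y + z} = S"
      using less.prems(1) x unfolding y_def z_def by simp
    ultimately consider "syn_closure A {y} = S" | "syn_closure A {z} = S"
      using join_irreducible_syn_closure_add[OF ji, of y z "{z}"] by blast
    then show ?thesis
    proof cases
      case 1
      moreover have "(shiftop A a ^^ e) y = 0"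
        using r unfolding y_def poly_act_linear_power .
      ultimately show ?thesis
        by blast
    next
      case 2
      show ?thesis
        using \<open>degree q < degree p\<close> 2 \<open>q \<noteq> 0\<close> s unfolding z_def by (rule less.hyps)
    qed
  qed
qed

lemma join_irreducible_jordan_generator:
  fixes A :: "nat^'n^'n"
  assumes reg: "regular_network A v" and ji: "join_irreducible A S"
  obtains l W where "jordan_subspace A l W" and "syn_closure A W = S"
proof -
  obtain x where x: "syn_closure A {x} = S"
    using join_irreducible_single_generator[OF ji] by blast
  obtain p where "p \<noteq> 0" and "poly_act ((*v) (cmat A)) p x = 0"
    using poly_act_annihilator by blast
  then obtain y a e where y: "(shiftop A a ^^ e) y = 0" "syn_closure A {y} = S"
    using join_irreducible_generalized_eigenvector_generator[OF ji x] by blast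
  show ?thesis
  proof (cases "y = 0")
    case False
    then show ?thesis
      using that jordan_subspace_cyclic_subspace[OF False y(1)] syn_closure_cyclic_subspace y(2) by metis
  next
    case True
    \<comment> \<open>Then \<open>S\<close> is fully synchronous and also generated by the eigenvector \<open>1\<close> of \<open>v\<close>.\<close>
    have "0 \<in> full_sync" "1 \<in> full_sync"
      unfolding full_sync_def by simp_all
    then have "syn_closure A {1} = S"
      using y(2) True syn_closure_full_sync[OF reg] by metis
    moreover have "(shiftop A (of_nat v) ^^ 1) 1 = 0"
      by (simp add: shiftop_def cmat_mult_one[OF reg])
    ultimately show ?thesis
      using that jordan_subspace_cyclic_subspace[of 1] syn_closure_cyclic_subspace by (metis one_neq_zero)
  qed
qed

lemma minimal_jordan_generator:
  assumes reg: "regular_network A v" and ji: "join_irreducible A S"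
  obtains l W where "jordan_subspace A l W" and "syn_closure A W = S"
    and "\<And>l' W'. jordan_subspace A l' W' \<Longrightarrow> syn_closure A W' = S \<Longrightarrow> \<not> Pdiag W' \<subset> Pdiag W"
proof -
  define P where "P W \<longleftrightarrow> (\<exists>l. jordan_subspace A l W) \<and> syn_closure A W = S" for W
  obtain l0 W0 where "jordan_subspace A l0 W0" and "syn_closure A W0 = S"
    using join_irreducible_jordan_generator[OF reg ji] .
  then have "P W0"
    unfolding P_def by blast
  then obtain W where W: "P W" and least: "\<And>W'. P W' \<Longrightarrow> vec.dim (Pdiag W) \<le> vec.dim (Pdiag W')"
    using ex_has_least_nat[of P W0 "\<lambda>W. vec.dim (Pdiag W)"] by blast
  from W obtain l where "jordan_subspace A l W" and "syn_closure A W = S"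
    unfolding P_def by blast
  moreover have "\<not> Pdiag W' \<subset> Pdiag W" if "jordan_subspace A l' W'" and "syn_closure A W' = S" for l' W'
  proof
    assume "Pdiag W' \<subset> Pdiag W"
    then have "vec.dim (Pdiag W') < vec.dim (Pdiag W)"
      by (rule dim_Pdiag_psubset)
    moreover have "vec.dim (Pdiag W) \<le> vec.dim (Pdiag W')"
      using that by (intro least) (auto simp: P_def)
    ultimately show False
      by simp
  qed
  ultimately show ?thesis
    by (rule that)
qed

section \<open>Minimal Jordan generators are special\<close>

lemma jordan_chain_correction:
  fixes \<phi> :: "complex^'n \<Rightarrow> complex"
  assumes ys: "jordan_chain A l ys" and t: "(shiftop A l ^^ length ys) t = 0"
    and \<phi>: "Vector_Spaces.linear (*s) (*) \<phi>" and \<phi>_ys: "\<phi> (ys ! 0) \<noteq> 0"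
  obtains u where "u \<in> vec.span (set ys)" and "\<And>m. \<phi> ((shiftop A l ^^ m) (t - u)) = 0"
proof -
  let ?f = "shiftop A l"
  have hom: "module_hom (*s) (*) \<phi>"
    using \<phi> by (rule Vector_Spaces.linear.axioms(3))
  \<comment> \<open>Clear the values of \<open>\<phi>\<close> along the orbit of \<open>t\<close> from the top down, using \<open>ys ! r\<close>
     to correct the \<open>r\<close>-th iterate without disturbing the higher ones.\<close>
  have "\<exists>u\<in>vec.span (set ys). \<forall>m\<ge>r. \<phi> ((?f ^^ m) (t - u)) = 0" if "r \<le> length ys" for r
    using that
  proof (induction r rule: inc_induct)
    case base
    have "(?f ^^ m) (t - 0) = 0" if "length ys \<le> m" for m
      using shiftop_pow_vanishes_beyond[OF t that] by simp
    then show ?case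
      using module_hom.zero[OF hom] by (intro bexI[of _ 0] allI impI) (simp_all add: vec.span_zero)
  next
    case (step r)
    then obtain u where u: "u \<in> vec.span (set ys)" "\<forall>m\<ge>Suc r. \<phi> ((?f ^^ m) (t - u)) = 0"
      by blast
    define c where "c = \<phi> ((?f ^^ r) (t - u)) / \<phi> (ys ! 0)"
    define u' where "u' = u + c *s ys ! r"
    have "u' \<in> vec.span (set ys)"
      unfolding u'_def using u(1) step.hyps(2) vec.span_base[of "ys ! r" "set ys"]
      by (intro vec.span_add vec.span_scale) auto
    moreover have "\<phi> ((?f ^^ m) (t - u')) = 0" if "r \<le> m" for m
    proof -
      have "(?f ^^ m) (t - u') = (?f ^^ m) (t - u) - c *s (?f ^^ m) (ys ! r)"
        unfolding u'_def by (simp add: shiftop_pow_diff shiftop_pow_add shiftop_pow_scale)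
      moreover have "(?f ^^ m) (ys ! r) = (if m = r then ys ! 0 else 0)"
        using jordan_chain_shiftop_pow_nth[OF ys step.hyps(2), of m] that by auto
      ultimately show ?thesis
        using u(2) \<phi>_ys that unfolding c_def
        by (cases "m = r") (auto simp: module_hom.diff[OF hom] module_hom.scale[OF hom])
    qed
    ultimately show ?case
      by blast
  qed
  then obtain u where "u \<in> vec.span (set ys)" and "\<forall>m\<ge>0. \<phi> ((?f ^^ m) (t - u)) = 0"
    by blast
  then show ?thesis
    using that by simp
qed

lemma linear_coordinate_difference: "Vector_Spaces.linear (*s) (*) (\<lambda>x :: 'a::field^'n. x $ i - x $ j)"
  by (simp add: Vector_Spaces.linear_iff vec.vector_space_axioms
      vector_space_over_itself.vector_space_axioms algebra_simps)

lemma minimal_jordan_generator_Pdiag: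
  assumes minimal: "\<And>l' W'. jordan_subspace A l' W' \<Longrightarrow> syn_closure A W' = S \<Longrightarrow> \<not> Pdiag W' \<subset> Pdiag W"
    and "z \<noteq> 0" and "(shiftop A l ^^ k) z = 0" and "syn_closure A {z} = S"
    and Q: "polydiagonal Q" and orbit: "\<And>m. (shiftop A l ^^ m) z \<in> Pdiag W \<inter> Q"
  shows "Pdiag W \<subseteq> Q"
proof -
  have "Pdiag (cyclic_subspace A l z) \<subseteq> Pdiag W \<inter> Q"
    using orbit by (intro Pdiag_cyclic_subspace_least polydiagonal_Int polydiagonal_Pdiag Q)
  moreover have "jordan_subspace A l (cyclic_subspace A l z)"
    using assms(2,3) by (rule jordan_subspace_cyclic_subspace)
  then have "\<not> Pdiag (cyclic_subspace A l z) \<subset> Pdiag W"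
    using assms(4) by (intro minimal) (simp_all add: syn_closure_cyclic_subspace)
  ultimately show ?thesis
    by blast
qed

lemma shiftop_pow_diff_Pdiag:
  assumes "u \<in> cyclic_subspace A l y" and "cyclic_subspace A l y \<subseteq> Pdiag (cyclic_subspace A l t)"
  shows "(shiftop A l ^^ m) (t - u) \<in> Pdiag (cyclic_subspace A l t)"
proof -
  have "(shiftop A l ^^ m) t \<in> Pdiag (cyclic_subspace A l t)"
    using shiftop_pow_cyclic_subspace[OF cyclic_subspace_self] subset_Pdiag by blast
  moreover have "(shiftop A l ^^ m) u \<in> Pdiag (cyclic_subspace A l t)"
    using shiftop_pow_cyclic_subspace[OF assms(1)] assms(2) by blast
  ultimately have "(shiftop A l ^^ m) t - (shiftop A l ^^ m) u \<in> Pdiag (cyclic_subspace A l t)"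
    by (rule vec.subspace_diff[OF subspace_Pdiag])
  then show ?thesis
    by (simp only: shiftop_pow_diff)
qed

lemma coordinate_correction_generator:
  fixes A :: "nat^'n^'n"
  assumes ji: "join_irreducible A S" and ys: "jordan_chain A l ys"
    and gen: "syn_closure A {t} = S" and ann: "(shiftop A l ^^ length ys) t = 0"
    and ij: "(ys ! 0) $ i \<noteq> (ys ! 0) $ j"
    and U_W: "vec.span (set ys) \<subseteq> Pdiag (cyclic_subspace A l t)"
    and t_U: "t \<notin> vec.span (set ys)" and U_S: "syn_closure A (vec.span (set ys)) \<noteq> S"
  obtains z where "z \<noteq> 0" and "(shiftop A l ^^ length ys) z = 0" and "syn_closure A {z} = S"
    and "\<And>m. (shiftop A l ^^ m) z \<in> Pdiag (cyclic_subspace A l t) \<inter> {x. x $ i = x $ j}"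
proof -
  let ?f = "shiftop A l" and ?W = "cyclic_subspace A l t" and ?U = "vec.span (set ys)"
  have U_cyc: "?U = cyclic_subspace A l (last ys)"
    using ys by (rule jordan_chain_span)
  define \<phi> :: "complex^'n \<Rightarrow> complex" where "\<phi> = (\<lambda>x. x $ i - x $ j)"
  have "Vector_Spaces.linear (*s) (*) \<phi>" and "\<phi> (ys ! 0) \<noteq> 0"
    unfolding \<phi>_def using linear_coordinate_difference ij by simp_all
  then obtain u where u: "u \<in> ?U" and eq0: "\<And>m. \<phi> ((?f ^^ m) (t - u)) = 0"
    using jordan_chain_correction[OF ys ann] by blast
  have orbit: "(?f ^^ m) (t - u) \<in> Pdiag ?W \<inter> {x. x $ i = x $ j}" for m
  proof -
    have "(?f ^^ m) (t - u) \<in> Pdiag ?W"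
      using u U_W unfolding U_cyc by (rule shiftop_pow_diff_Pdiag)
    moreover have "((?f ^^ m) (t - u)) $ i = ((?f ^^ m) (t - u)) $ j"
      using eq0[of m] unfolding \<phi>_def right_minus_eq .
    ultimately show ?thesis
      by blast
  qed
  have "t - u \<noteq> 0"
    using u t_U by auto
  moreover have "(?f ^^ length ys) (t - u) = 0"
    using ann cyclic_subspace_annihilated[OF jordan_chain_last_annihilated[OF ys] u[unfolded U_cyc]]
    unfolding shiftop_pow_diff by simp
  \<comment> \<open>\<open>t = (t - u) + u\<close> generates \<open>S\<close> while the span of \<open>ys\<close> does not.\<close>
  moreover have "syn_closure A {t - u} = S"
  proof -
    have "?W \<subseteq> S"
      unfolding gen[symmetric] syn_closure_cyclic_subspace[of A l t, symmetric] by (rule subset_syn_closure)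
    then have W_S: "Pdiag ?W \<subseteq> S"
      using join_irreducible_synchrony[OF ji] unfolding synchrony_def by (intro Pdiag_least) auto
    have "syn_closure A {(t - u) + u} = S"
      using gen by simp
    moreover have "t - u \<in> S"
      using orbit[of 0] W_S by auto
    moreover have "?U \<subseteq> S"
      using U_W W_S by (rule order.trans)
    ultimately show ?thesis
      using join_irreducible_syn_closure_add[OF ji _ _ u] U_S by blast
  qed
  ultimately show ?thesis
    using that orbit by blast
qed

lemma minimal_jordan_generator_eigenvector_synchronous:
  fixes A :: "nat^'n^'n"
  assumes ji: "join_irreducible A S"
    and xs: "jordan_chain A l xs" and S: "syn_closure A (vec.span (set xs)) = S"
    and minimal: "\<And>l' W'. jordan_subspace A l' W' \<Longrightarrow> syn_closure A W' = S \<Longrightarrow>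
      \<not> Pdiag W' \<subset> Pdiag (vec.span (set xs))"
    and ys: "jordan_chain A l ys" and len: "length ys = length xs"
    and psub: "Pdiag (vec.span (set ys)) \<subset> Pdiag (vec.span (set xs))"
  shows "ys ! 0 \<in> full_sync"
proof (rule ccontr)
  define t where "t = last xs"
  let ?W = "cyclic_subspace A l t" and ?U = "vec.span (set ys)"
  have W: "vec.span (set xs) = ?W"
    unfolding t_def using xs by (rule jordan_chain_span)
  have U_W: "?U \<subseteq> Pdiag ?W"
    using subset_Pdiag[of ?U] psub unfolding W by blast
  have t_U: "t \<notin> ?U"
  proof
    assume "t \<in> ?U"
    then have "?W \<subseteq> ?U"
      unfolding jordan_chain_span[OF ys] by (rule cyclic_subspace_subset)
    then have "Pdiag ?W \<subseteq> Pdiag ?U"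
      by (intro Pdiag_least polydiagonal_Pdiag order.trans[OF _ subset_Pdiag])
    with psub show False
      unfolding W by blast
  qed
  have U_S: "syn_closure A ?U \<noteq> S"
    using minimal[OF jordan_subspace_span_chain[OF ys]] psub by blast
  have gen: "syn_closure A {t} = S"
    using S unfolding W syn_closure_cyclic_subspace .
  have ann: "(shiftop A l ^^ length ys) t = 0"
    using jordan_chain_last_annihilated[OF xs] unfolding t_def len .
  assume "ys ! 0 \<notin> full_sync"
  then obtain i j where ij: "(ys ! 0) $ i \<noteq> (ys ! 0) $ j"
    unfolding full_sync_def by blast
  obtain z where "z \<noteq> 0" "(shiftop A l ^^ length ys) z = 0" "syn_closure A {z} = S"
    and orbit: "\<And>m. (shiftop A l ^^ m) z \<in> Pdiag ?W \<inter> {x. x $ i = x $ j}"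
    using coordinate_correction_generator[OF ji ys gen ann ij U_W t_U U_S] by blast
  then have "Pdiag ?W \<subseteq> {x. x $ i = x $ j}"
    using minimal unfolding W by (intro minimal_jordan_generator_Pdiag polydiagonal_coordinates_eq) auto
  moreover have "ys ! 0 \<in> Pdiag ?W"
    using U_W ys vec.span_base[of "ys ! 0" "set ys"] unfolding jordan_chain_def by auto
  ultimately show False
    using ij by blast
qed

lemma shiftop_valency_ne_one:
  fixes A :: "nat^'n^'n"
  assumes reg: "regular_network A v"
  shows "shiftop A (of_nat v) z \<noteq> 1"
proof
  assume z: "shiftop A (of_nat v) z = 1"
  \<comment> \<open>Maximum principle: at a coordinate where \<open>Re z\<close> is largest, \<open>A z - v z\<close> has non-positive real part.\<close>
  define w where "w i = Re (z $ i)" for i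
  have fin: "finite (range w)"
    by simp
  then have "Max (range w) \<in> range w"
    by (rule Max_in) simp
  then obtain i0 where "w i0 = Max (range w)"
    by (metis imageE)
  then have i0: "w j \<le> w i0" for j
    using fin by simp
  have "Re ((cmat A *v z) $ i0) = (\<Sum>j\<in>UNIV. real (A $ i0 $ j) * w j)"
    unfolding cmat_def matrix_vector_mult_def w_def by simp
  also have "\<dots> \<le> (\<Sum>j\<in>UNIV. real (A $ i0 $ j) * w i0)"
    by (rule sum_mono) (simp add: mult_left_mono i0)
  also have "\<dots> = real v * w i0"
    using reg unfolding regular_network_def by (simp flip: sum_distrib_right of_nat_sum)
  finally have "Re ((cmat A *v z) $ i0) - real v * w i0 \<le> 0"
    by simp
  moreover have "(cmat A *v z - of_nat v *s z) $ i0 = (1 :: complex^'n) $ i0"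
    using z unfolding shiftop_def by (rule arg_cong)
  then have "Re ((cmat A *v z) $ i0 - of_nat v * z $ i0) = 1"
    by simp
  then have "Re ((cmat A *v z) $ i0) - real v * w i0 = 1"
    unfolding w_def by simp
  ultimately show False
    by simp
qed

lemma jordan_chain_full_sync:
  fixes A :: "nat^'n^'n"
  assumes reg: "regular_network A v" and ys: "jordan_chain A l ys" and sync: "ys ! 0 \<in> full_sync"
  shows "vec.span (set ys) = full_sync"
proof -
  obtain c where c: "ys ! 0 = c *s 1"
    using sync unfolding full_sync_eq by blast
  have "ys \<noteq> []" and "ys ! 0 \<noteq> 0" and "shiftop A l (ys ! 0) = 0"
    using ys unfolding jordan_chain_def by auto
  then have "c \<noteq> 0"
    using c by auto
  have "shiftop A l (ys ! 0) = (c * of_nat v - l * c) *s 1"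
    unfolding c shiftop_def by (simp add: vec.scale cmat_mult_one[OF reg])
  then have "(c * of_nat v - l * c) *s (1 :: complex^'n) = 0"
    using \<open>shiftop A l (ys ! 0) = 0\<close> by simp
  then have "c * (of_nat v - l) = 0"
    by (simp add: vec_eq_iff algebra_simps)
  with \<open>c \<noteq> 0\<close> have l: "l = of_nat v"
    by simp
  have "length ys = 1"
  proof (rule ccontr)
    assume "length ys \<noteq> 1"
    with \<open>ys \<noteq> []\<close> have "1 < length ys"
      by (cases ys) auto
    then have "shiftop A l (ys ! 1) = ys ! 0"
      using jordan_chain_shiftop_pow_nth[OF ys, of 1 1] by simp
    then have "shiftop A (of_nat v) ((1 / c) *s ys ! 1) = 1"
      using \<open>c \<noteq> 0\<close> unfolding l c shiftop_scale by simp
    then show False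
      using shiftop_valency_ne_one[OF reg] by blast
  qed
  then obtain y where "ys = [y]"
    by (auto simp: length_Suc_conv)
  then show ?thesis
    using c span_scaled_one[OF \<open>c \<noteq> 0\<close>] by simp
qed

lemma minimal_jordan_generator_special:
  fixes A :: "nat^'n^'n"
  assumes reg: "regular_network A v" and ji: "join_irreducible A S"
    and W: "jordan_subspace A l W" and S: "syn_closure A W = S"
    and minimal: "\<And>l' W'. jordan_subspace A l' W' \<Longrightarrow> syn_closure A W' = S \<Longrightarrow> \<not> Pdiag W' \<subset> Pdiag W"
  shows "special_jordan A W"
  unfolding special_jordan_def
proof (intro exI conjI allI impI)
  show "jordan_subspace A l W"
    by (rule W)
  fix U assume U: "jordan_subspace A l U \<and> vec.dim U = vec.dim W \<and> Pdiag U \<subseteq> Pdiag W"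
  obtain xs where xs: "jordan_chain A l xs" "W = vec.span (set xs)"
    using W unfolding jordan_subspace_def by blast
  obtain ys where ys: "jordan_chain A l ys" "U = vec.span (set ys)"
    using U unfolding jordan_subspace_def by blast
  show "Pdiag U = Pdiag W \<or> U = full_sync"
  proof (cases "Pdiag U = Pdiag W")
    case False
    with U have "Pdiag (vec.span (set ys)) \<subset> Pdiag (vec.span (set xs))"
      unfolding xs(2) ys(2) by blast
    moreover have "length ys = length xs"
      using U jordan_chain_dim[OF xs(1)] jordan_chain_dim[OF ys(1)] unfolding xs(2) ys(2) by simp
    ultimately have "ys ! 0 \<in> full_sync"
      using minimal_jordan_generator_eigenvector_synchronous[OF ji xs(1) _ _ ys(1)] S minimal
      unfolding xs(2) by blast
    then have "U = full_sync"
      unfolding ys(2) by (rule jordan_chain_full_sync[OF reg ys(1)])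
    then show ?thesis ..
  qed simp
qed

lemma join_irreducible_special_generator:
  fixes A :: "nat^'n^'n"
  assumes reg: "regular_network A v" and ji: "join_irreducible A S"
  shows "\<exists>W. special_jordan A W \<and> S = syn_closure A W"
proof -
  obtain l W where W: "jordan_subspace A l W" and S: "syn_closure A W = S"
    and minimal: "\<And>l' W'. jordan_subspace A l' W' \<Longrightarrow> syn_closure A W' = S \<Longrightarrow> \<not> Pdiag W' \<subset> Pdiag W"
    using minimal_jordan_generator[OF reg ji] by blast
  have "special_jordan A W"
    using reg ji W S minimal by (rule minimal_jordan_generator_special)
  with S show ?thesis
    by blast
qed

theorem mainTheorem10:
  fixes A :: "nat^'n^'n" and v :: nat
  assumes "regular_network A v"
  shows "(\<forall>S. join_irreducible A S \<longrightarrow> (\<exists>W. special_jordan A W \<and> S = syn_closure A W))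
       \<and> (\<exists>f. inj_on f {S. join_irreducible A S} \<and> f ` {S. join_irreducible A S} \<subseteq> {W. special_jordan A W})"
proof
  show generator: "\<forall>S. join_irreducible A S \<longrightarrow> (\<exists>W. special_jordan A W \<and> S = syn_closure A W)"
    using join_irreducible_special_generator[OF assms] by blast
  define f where "f S = (SOME W. special_jordan A W \<and> S = syn_closure A W)" for S
  have f: "special_jordan A (f S) \<and> S = syn_closure A (f S)" if "join_irreducible A S" for S
  proof -
    have "\<exists>W. special_jordan A W \<and> S = syn_closure A W"
      using generator that by blast
    then show ?thesis
      unfolding f_def by (rule someI_ex)
  qed
  have "inj_on f {S. join_irreducible A S}"
    by (rule inj_on_inverseI[where g = "syn_closure A"]) (simp add: f[THEN conjunct2, symmetric])
  moreover have "f ` {S. join_irreducible A S} \<subseteq> {W. special_jordan A W}"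
    using f by blast
  ultimately show "\<exists>f. inj_on f {S. join_irreducible A S} \<and> f ` {S. join_irreducible A S} \<subseteq> {W. special_jordan A W}"
    by blast
qed

end
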